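(* Consider the linear model, the collection of clusters $\mathcal{C}$, the $B$ sample splits with screened sets $\hat S^{(1)},\dots,\hat S^{(B)}$, the p-values $p^{C,(b)}$, the multiplicity adjustments $m^{(b)}_C(\mathcal{R})$, the aggregation procedure $\mathrm{aggr}$, and the sequential rejection procedure $(\mathcal{R}_i)_{i\in\mathbb{N}_0\cup\{\infty\}}$ at level $\alpha\in(0,1)$, all as described in the context. Assume the following. (A1) Sparsity property: for any sample split $b$, $|\hat S^{(b)}|<n/2$. (A2) $\delta$-screening property: for any sample split $b$, $\mathbb{P}[\hat S^{(b)}\supseteq S_0]\ge 1-\delta$, where $0<\delta<1$. (A3) Correct testing property: for each sample split $b$, each $C\in\mathcal{C}$ and each screened set $\hat S^{(b)}$, under the null hypothesis $H_{0,C\cap\hat S^{(b)}}$ it holds that $\mathbb{P}[p^{C,(b)}\le a]\le a$ for each $a\in(0,1)$. Here the probability is with respect to the data generating random variables corresponding to the second half-sample $N_{out}^{(b)}$ of that split, and the null hypothesis $H_{0,C\cap\hat S^{(b)}}$ is fixed with respect to $N_{out}^{(b)}$. (A4) Monotonicity property: for each $b$ and each $C\in\mathcal{C}$, if $\mathcal{R}\subseteq\mathcal{S}$ (subcollections of $\mathcal{C}$), then $m^{(b)}_C(\mathcal{R})\ge m^{(b)}_C(\mathcal{S})$. (A5) Single-step property: for each $b$ and each $\mathcal{R}\subseteq\mathcal{C}$, $$\sum_{C\in\mathcal{C}\setminus\mathcal{R}}\frac{1\{C\cap\hat S^{(b)}\neq\emptyset\}}{m^{(b)}_C(\mathcal{R})}\le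 1,\qquad\text{where } 1/\infty=0.$$ (A6) Aggregation property: consider a collection of screened sets $\hat S^{(b)}$, a cluster $C\in\mathcal{C}$, a collection of p-values $p^{C,(b)}$ for the null hypotheses $H_{0,C\cap\hat S^{(b)}}$, and a collection of multiplicity adjustments $m_C^{(b)}\ge 1$ (dependence on $\mathcal{R}$ dropped), $b=1,\dots,B$. If $\mathbb{P}[p^{C,(b)}\le a]\le a$ for all $a\in[0,1]$, then $$\mathbb{P}\big[\mathrm{aggr}(p^{C,(1)}m_C^{(1)},\dots,p^{C,(B)}m_C^{(B)})\le a\big]\ \le\ \frac{a}{B}\sum_{b=1}^B\frac{1\{C\cap\hat S^{(b)}\neq\emptyset\}}{m_C^{(b)}}\qquad\text{for all } a\in[0,1).$$ Then for any $i\in\mathbb{N}_0\cup\{\infty\}$, $$\mathbb{P}[\mathcal{R}_i\subseteq\mathcal{F}]\ \ge\ (1-\delta)^B-\alpha,$$ where $\mathcal{F}=\{C\in\mathcal{C}:\ C\cap S_0\neq\emptyset\}$ is the collection of false null hypotheses.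
   Context: **Model.** $\mathbf{Y}=\mathbf{X}\beta^0+\varepsilon$ with $\varepsilon\sim\mathcal{N}_n(0,\sigma^2 I)$, an $n\times p$ design matrix $\mathbf{X}$ (fixed, or conditioned on) and a $p\times 1$ regression vector $\beta^0$, where $p\gg n$ is allowed. The active set is $S_0=\{j:\beta^0_j\neq0\}\subseteq\{1,\dots,p\}$. $\mathcal{C}$ is a collection of subsets ("clusters") of $\{1,\dots,p\}$. For $C\subseteq\{1,\dots,p\}$ the null hypothesis $H_{0,C}$ is: $\beta^0_j=0$ for all $j\in C$; the alternative is that $\beta^0_j\neq 0$ for at least one $j\in C$. **Sample splitting and screening.** For $b=1,\dots,B$ a partition $\{1,\dots,n\}=N_{in}^{(b)}\cup N_{out}^{(b)}$ into two disjoint groups is randomly chosen, with groups of equal size if $n$ is even and $|N_{out}^{(b)}|=|N_{in}^{(b)}|+1$ if $n$ is odd. A screened set $\hat S^{(b)}\subseteq\{1,\dots,p\}$ is computed from the data corresponding to $N_{in}^{(b)}$. **p-values.** For each split $b$ and each $C\in\mathcal{C}$, a testing procedure based on the data corresponding to $N_{out}^{(b)}$ gives a p-value $p^{C,(b)}\in[0,1]$ for the null hypothesis $H_{0,C\cap\hat S^{(b)}}$. If $C\cap\hat S^{(b)}=\emptyset$, one defines $p^{C,(b)}=1$. **Multiplicity adjustments.** For each split $b$ and each $C\in\mathcal{C}$ there is a map $m^{(b)}_C:2^{\mathcal{C}}\to[1,\infty]$ which gives, for each collection $\mathcal{R}\subseteq\mathcal{C}$ of rejected clusters, a multiplicity adjustment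 $m^{(b)}_C(\mathcal{R})\ge1$ (it may depend on $\hat S^{(b)}$). **Aggregation.** An aggregation procedure is a monotone increasing function $\mathrm{aggr}:[0,1]^B\to[0,1]$. Adjusted p-values $p^{C,(b)}m^{(b)}_C$ exceeding $1$ are understood as truncated at $1$ when inserted in $\mathrm{aggr}$. **Sequential procedure.** For $\alpha\in(0,1)$ and $\mathcal{R}\subseteq\mathcal{C}$ define the successor $$\mathcal{N}(\mathcal{R})=\{C\in\mathcal{C}\setminus\mathcal{R}:\ \mathrm{aggr}(p^{C,(1)}m^{(1)}_C(\mathcal{R}),\dots,p^{C,(B)}m^{(B)}_C(\mathcal{R}))\le\alpha\}.$$ Set $\mathcal{R}_0=\emptyset$, $\mathcal{R}_{i+1}=\mathcal{R}_i\cup\mathcal{N}(\mathcal{R}_i)$ for $i\in\mathbb{N}_0$, and $\mathcal{R}_\infty=\lim_{i\to\infty}\mathcal{R}_i$. *)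

theory Defs
  imports "HOL-Probability.Probability"
begin

text \<open>Observations are indexed by \<open>{1..n}\<close>, covariates by \<open>{1..p}\<close> and sample splits by
  \<open>{1..B}\<close>. Vectors are functions on \<open>nat\<close> restricted to the index set.\<close>

definition responses :: "nat \<Rightarrow> nat \<Rightarrow> (nat \<Rightarrow> nat \<Rightarrow> real) \<Rightarrow> (nat \<Rightarrow> real) \<Rightarrow> (nat \<Rightarrow> real) \<Rightarrow> nat \<Rightarrow> real"
  where "responses n p X \<beta> e = (\<lambda>i\<in>{1..n}. (\<Sum>j=1..p. X i j * \<beta> j) + e i)"

definition active_set :: "nat \<Rightarrow> (nat \<Rightarrow> real) \<Rightarrow> nat set"
  where "active_set p \<beta> = {j \<in> {1..p}. \<beta> j \<noteq> 0}"

definition null_hyp :: "(nat \<Rightarrow> real) \<Rightarrow> nat set \<Rightarrow> bool"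
  where "null_hyp \<beta> C \<longleftrightarrow> (\<forall>j\<in>C. \<beta> j = 0)"

definition false_nulls :: "nat \<Rightarrow> (nat \<Rightarrow> real) \<Rightarrow> nat set set \<Rightarrow> nat set set"
  where "false_nulls p \<beta> \<C> = {C \<in> \<C>. C \<inter> active_set p \<beta> \<noteq> {}}"

text \<open>A split is represented by its first half \<open>N\<close>; the second half is \<open>{1..n} - N\<close>.\<close>

definition splits :: "nat \<Rightarrow> nat set set"
  where "splits n = {N. N \<subseteq> {1..n} \<and>
    card ({1..n} - N) = (if even n then card N else card N + 1)}"

text \<open>The joint law of the noise and the \<open>B\<close> splits: i.i.d. centred Gaussian noise, and i.i.d.
  uniform splits that are independent of the noise.\<close>

definition noise_split_law :: "nat \<Rightarrow> real \<Rightarrow> nat \<Rightarrow> ((nat \<Rightarrow> real) \<times> (nat \<Rightarrow> nat set)) measure"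
  where "noise_split_law n \<sigma> B =
    (\<Pi>\<^sub>M i\<in>{1..n}. density lborel (\<lambda>x. ennreal (normal_density 0 \<sigma> x))) \<Otimes>\<^sub>M
    (\<Pi>\<^sub>M b\<in>{1..B}. uniform_count_measure (splits n))"

text \<open>\<open>scr N d\<close> is the set selected from the data \<open>d\<close> of the half-sample \<open>N\<close>; restricting the
  response vector ensures that no other observation is used. The design is fixed, so \<open>scr\<close> and
  \<open>test\<close> may depend on it without taking it as an argument.\<close>

definition screened_set :: "(nat set \<Rightarrow> (nat \<Rightarrow> real) \<Rightarrow> nat set) \<Rightarrow> nat set \<Rightarrow> (nat \<Rightarrow> real) \<Rightarrow> nat set"
  where "screened_set scr N y = scr N (restrict y N)"

text \<open>\<open>test C S N' d\<close> is the p-value for the null hypothesis of \<open>C \<inter> S\<close> computed from the data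
  \<open>d\<close> of the half-sample \<open>N'\<close>.\<close>

definition split_pvalue :: "nat \<Rightarrow> (nat set \<Rightarrow> nat set \<Rightarrow> nat set \<Rightarrow> (nat \<Rightarrow> real) \<Rightarrow> real) \<Rightarrow>
    nat set \<Rightarrow> nat set \<Rightarrow> nat set \<Rightarrow> (nat \<Rightarrow> real) \<Rightarrow> real"
  where "split_pvalue n test C S N y =
    (if C \<inter> S = {} then 1 else test C S ({1..n} - N) (restrict y ({1..n} - N)))"

text \<open>Truncation at 1. An infinite adjustment gives 1 even if the p-value is 0 (in \<open>ereal\<close>,
  \<open>0 * \<infinity> = 0\<close>).\<close>

definition adj_pvalue :: "real \<Rightarrow> ereal \<Rightarrow> real"
  where "adj_pvalue q m = (if m = \<infinity> then 1 else min 1 (q * real_of_ereal m))"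

definition aggregation_procedure :: "nat \<Rightarrow> ((nat \<Rightarrow> real) \<Rightarrow> real) \<Rightarrow> bool"
  where "aggregation_procedure B aggr \<longleftrightarrow>
    aggr \<in> (\<Pi>\<^sub>M b\<in>{1..B}. restrict_space borel {0..1}) \<rightarrow>\<^sub>M restrict_space borel {0..1} \<and>
    mono_on (\<Pi>\<^sub>E b\<in>{1..B}. {0..1}) aggr"

text \<open>A property of \<open>aggr\<close> alone: it concerns fixed screened sets and adjustments, and arbitrarily
  dependent p-values. Every joint law of \<open>B\<close> p-values is realised on a probability space over
  \<open>nat \<Rightarrow> real\<close>, so the choice of this type is no restriction.\<close>

definition aggregation_property :: "nat \<Rightarrow> ((nat \<Rightarrow> real) \<Rightarrow> real) \<Rightarrow> nat \<Rightarrow> nat set set \<Rightarrow> bool"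
  where "aggregation_property B aggr p \<C> \<longleftrightarrow>
    (\<forall>(S :: nat \<Rightarrow> nat set) C (m :: nat \<Rightarrow> ereal) (Q :: (nat \<Rightarrow> real) measure) P.
      (\<forall>b\<in>{1..B}. S b \<subseteq> {1..p}) \<longrightarrow> C \<in> \<C> \<longrightarrow> (\<forall>b\<in>{1..B}. 1 \<le> m b) \<longrightarrow> prob_space Q \<longrightarrow>
      (\<forall>b\<in>{1..B}. P b \<in> Q \<rightarrow>\<^sub>M restrict_space borel {0..1} \<and>
        (C \<inter> S b = {} \<longrightarrow> (\<forall>x\<in>space Q. P b x = 1)) \<and>
        (\<forall>a\<in>{0..1}. measure Q {x \<in> space Q. P b x \<le> a} \<le> a)) \<longrightarrow>
      (\<forall>a\<in>{0..<1}.
        ereal (measure Q {x \<in> space Q. aggr (\<lambda>b\<in>{1..B}. adj_pvalue (P b x) (m b)) \<le> a})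
        \<le> ereal (a / real B) * (\<Sum>b=1..B. of_bool (C \<inter> S b \<noteq> {}) / m b)))"

text \<open>Below, \<open>P b C\<close> and \<open>m b C \<R>\<close> are the p-values and multiplicity adjustments of one
  realisation.\<close>

definition successor :: "nat \<Rightarrow> ((nat \<Rightarrow> real) \<Rightarrow> real) \<Rightarrow> real \<Rightarrow> nat set set \<Rightarrow>
    (nat \<Rightarrow> nat set \<Rightarrow> real) \<Rightarrow> (nat \<Rightarrow> nat set \<Rightarrow> nat set set \<Rightarrow> ereal) \<Rightarrow> nat set set \<Rightarrow> nat set set"
  where "successor B aggr \<alpha> \<C> P m \<R> =
    {C \<in> \<C> - \<R>. aggr (\<lambda>b\<in>{1..B}. adj_pvalue (P b C) (m b C \<R>)) \<le> \<alpha>}"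

primrec rejected_nat :: "nat \<Rightarrow> ((nat \<Rightarrow> real) \<Rightarrow> real) \<Rightarrow> real \<Rightarrow> nat set set \<Rightarrow>
    (nat \<Rightarrow> nat set \<Rightarrow> real) \<Rightarrow> (nat \<Rightarrow> nat set \<Rightarrow> nat set set \<Rightarrow> ereal) \<Rightarrow> nat \<Rightarrow> nat set set"
  where
    "rejected_nat B aggr \<alpha> \<C> P m 0 = {}"
  | "rejected_nat B aggr \<alpha> \<C> P m (Suc i) = rejected_nat B aggr \<alpha> \<C> P m i \<union>
       successor B aggr \<alpha> \<C> P m (rejected_nat B aggr \<alpha> \<C> P m i)"

text \<open>The sequence is increasing, so its limit is its union.\<close>

definition rejected :: "nat \<Rightarrow> ((nat \<Rightarrow> real) \<Rightarrow> real) \<Rightarrow> real \<Rightarrow> nat set set \<Rightarrow>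
    (nat \<Rightarrow> nat set \<Rightarrow> real) \<Rightarrow> (nat \<Rightarrow> nat set \<Rightarrow> nat set set \<Rightarrow> ereal) \<Rightarrow> enat \<Rightarrow> nat set set"
  where "rejected B aggr \<alpha> \<C> P m i =
    (case i of enat k \<Rightarrow> rejected_nat B aggr \<alpha> \<C> P m k
             | \<infinity> \<Rightarrow> (\<Union>k. rejected_nat B aggr \<alpha> \<C> P m k))"

end

theory Submission imports Defs begin

text \<open>A cluster without active variables satisfies its null hypothesis whatever was screened, so its
  p-values are always valid and it suffices to bound the probability of a false rejection by \<open>\<alpha>\<close>.
  By monotonicity of the adjustments, leaving the set \<open>F\<close> of false nulls for the first time
  requires that some true null is rejected with its adjustment at \<open>F\<close>; a union bound with the
  single-step property at \<open>F\<close> bounds this event. The aggregation property is stated for fixed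
  screened sets and adjustments, and the p-values of different splits need not be valid jointly
  given all screened sets. But \<open>q = min 1 (p m)\<close> satisfies \<open>P(q \<le> t) \<le> t w\<close> with
  \<open>w = E[1/m]\<close>, so \<open>q\<close> is also the adjusted value of the valid p-value \<open>q w\<close> (if \<open>q < 1\<close>) or \<open>1\<close>
  (otherwise) with the deterministic adjustment \<open>1/w\<close>.\<close>

section \<open>Independence of the two half-samples\<close>

text \<open>\<open>merge\<close> carries the product of \<open>PiM J D\<close> and
  \<open>PiM (I - J) D\<close> to \<open>PiM I D\<close>, and under it the event on the left becomes
  the rectangle \<open>A \<times> A'\<close>. Restrictions to complementary index sets are therefore
  independent.\<close>

lemma PiM_complementary_restrictions:
  fixes D :: "'i \<Rightarrow> 'a measure"
  assumes "\<And>i. prob_space (D i)" and "finite I" and "J \<subseteq> I"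
    and A: "A \<in> sets (PiM J D)" and A': "A' \<in> sets (PiM (I - J) D)"
  shows "measure (PiM I D) {e \<in> space (PiM I D). restrict e J \<in> A \<and> restrict e (I - J) \<in> A'}
    = measure (PiM J D) A * measure (PiM (I - J) D) A'"
proof -
  interpret product_prob_space D
    using assms(1) by (intro product_prob_spaceI)
  interpret K: prob_space "PiM (I - J) D"
    by (intro prob_space_PiM assms(1))
  define E where "E = {e \<in> space (PiM I D). restrict e J \<in> A \<and> restrict e (I - J) \<in> A'}"
  have fin: "finite J" "finite (I - J)" and I: "J \<union> (I - J) = I"
    using assms finite_subset by auto
  have E: "E \<in> sets (PiM I D)"
  proof -
    have "E = ((\<lambda>e. restrict e J) -` A \<inter> space (PiM I D)) \<inter>
        ((\<lambda>e. restrict e (I - J)) -` A' \<inter> space (PiM I D))"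
      by (auto simp: E_def)
    also have "\<dots> \<in> sets (PiM I D)"
      using A A' \<open>J \<subseteq> I\<close>
      by (intro sets.Int measurable_sets[OF measurable_restrict_subset]) auto
    finally show ?thesis .
  qed
  have "emeasure (PiM I D) E
      = emeasure (distr (PiM J D \<Otimes>\<^sub>M PiM (I - J) D) (PiM I D) (merge J (I - J))) E"
    using distr_merge[of J "I - J"] fin I by simp
  also have "\<dots> = emeasure (PiM J D \<Otimes>\<^sub>M PiM (I - J) D)
      (merge J (I - J) -` E \<inter> space (PiM J D \<Otimes>\<^sub>M PiM (I - J) D))"
    using measurable_merge[of J "I - J" D] E I by (intro emeasure_distr) auto
  also have "merge J (I - J) -` E \<inter> space (PiM J D \<Otimes>\<^sub>M PiM (I - J) D) = A \<times> A'"
  proof -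
    have "merge J (I - J) (x, y) \<in> E \<longleftrightarrow> x \<in> A \<and> y \<in> A'"
      if "x \<in> space (PiM J D)" "y \<in> space (PiM (I - J) D)" for x y
    proof -
      have "merge J (I - J) (x, y) \<in> space (PiM I D)"
        using measurable_space[OF measurable_merge[of J "I - J" D], of "(x, y)"] that I
        by (simp add: space_pair_measure)
      moreover have "restrict (merge J (I - J) (x, y)) J = x"
        "restrict (merge J (I - J) (x, y)) (I - J) = y"
        using that by (auto simp: space_PiM PiE_def restrict_merge extensional_restrict)
      ultimately show ?thesis by (simp add: E_def)
    qed
    then show ?thesis
      using sets.sets_into_space[OF A] sets.sets_into_space[OF A']
      unfolding space_pair_measure by blast
  qed
  also have "emeasure (PiM J D \<Otimes>\<^sub>M PiM (I - J) D) (A \<times> A')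
      = emeasure (PiM J D) A * emeasure (PiM (I - J) D) A'"
    by (rule K.emeasure_pair_measure_Times[OF A A'])
  finally show ?thesis
    by (simp add: E_def measure_def enn2real_mult)
qed

lemma finite_splits: "finite (splits n)"
  by (rule finite_subset[of _ "Pow {1..n}"]) (auto simp: splits_def)

text \<open>For a fixed split \<open>N\<close>, the second half of the noise is independent of the
  pair formed by the random split and the first half. Two factorizations combine: the joint law
  separates noise from splits, and the noise law separates \<open>N\<close> from its
  complement.\<close>

lemma noise_split_law_factorization:
  fixes M :: "'w measure"
  assumes \<sigma>: "0 < \<sigma>"
    and eps [measurable]: "eps \<in> M \<rightarrow>\<^sub>M (\<Pi>\<^sub>M k\<in>{1..n}. borel)"
    and Nin [measurable]: "Nin \<in> M \<rightarrow>\<^sub>M (\<Pi>\<^sub>M b\<in>{1..B}. count_space (splits n))"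
    and law: "distr M ((\<Pi>\<^sub>M k\<in>{1..n}. borel) \<Otimes>\<^sub>M (\<Pi>\<^sub>M b\<in>{1..B}. count_space (splits n)))
        (\<lambda>\<omega>. (eps \<omega>, Nin \<omega>)) = noise_split_law n \<sigma> B"
    and b: "b \<in> {1..B}" and N: "N \<in> splits n"
    and A: "A \<in> sets (\<Pi>\<^sub>M k\<in>N. borel)" and A': "A' \<in> sets (\<Pi>\<^sub>M k\<in>{1..n} - N. borel)"
  shows "measure M {\<omega> \<in> space M. Nin \<omega> b = N \<and> restrict (eps \<omega>) N \<in> A \<and>
        restrict (eps \<omega>) ({1..n} - N) \<in> A'}
    = measure M {\<omega> \<in> space M. Nin \<omega> b = N \<and> restrict (eps \<omega>) N \<in> A} *
      measure M {\<omega> \<in> space M. restrict (eps \<omega>) ({1..n} - N) \<in> A'}"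
proof -
  let ?D = "\<lambda>i::nat. density lborel (\<lambda>x. ennreal (normal_density 0 \<sigma> x))"
  let ?I = "{1..n}"
  let ?L = "PiM ?I ?D"
  let ?U = "\<Pi>\<^sub>M b\<in>{1..B}. uniform_count_measure (splits n)"
  have D: "prob_space (?D i)" for i
    using \<sigma> by (rule prob_space_normal_density)
  interpret U: prob_space ?U
    using finite_splits N by (intro prob_space_PiM prob_space_uniform_count_measure) auto
  interpret L: prob_space ?L
    by (intro prob_space_PiM D)
  have setsL: "sets (PiM J ?D) = sets (\<Pi>\<^sub>M k\<in>J. borel)" for J
    by (intro sets_PiM_cong) auto
  have setsU: "sets ?U = sets (\<Pi>\<^sub>M b\<in>{1..B}. count_space (splits n))"
    by (intro sets_PiM_cong) (auto simp: sets_uniform_count_measure)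
  have NI: "N \<subseteq> ?I"
    using N by (simp add: splits_def)
  \<comment> \<open>The joint law enters only through its values on rectangles of a noise event and
    a split event.\<close>
  have prod: "measure M {\<omega> \<in> space M. eps \<omega> \<in> E \<and> Nin \<omega> \<in> G} = measure ?L E * measure ?U G"
    if E: "E \<in> sets ?L" and G: "G \<in> sets ?U" for E G
  proof -
    have "{\<omega> \<in> space M. eps \<omega> \<in> E \<and> Nin \<omega> \<in> G} = (\<lambda>\<omega>. (eps \<omega>, Nin \<omega>)) -` (E \<times> G) \<inter> space M"
      by auto
    then have "measure M {\<omega> \<in> space M. eps \<omega> \<in> E \<and> Nin \<omega> \<in> G}
        = measure (noise_split_law n \<sigma> B) (E \<times> G)"
      using E G unfolding law[symmetric] setsL setsU
      by (subst measure_distr[OF measurable_Pair[OF eps Nin] pair_measureI]) simp_all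
    also have "\<dots> = measure ?L E * measure ?U G"
      unfolding noise_split_law_def measure_def
      by (subst U.emeasure_pair_measure_Times[OF E G]) (simp add: enn2real_mult)
    finally show ?thesis .
  qed
  define G where "G = {f \<in> space ?U. f b = N}"
  have G: "G \<in> sets ?U"
  proof -
    have "G = (\<lambda>f. f b) -` {N} \<inter> space ?U" by (auto simp: G_def)
    also have "\<dots> \<in> sets ?U"
      using b N by (intro measurable_sets[OF measurable_component_singleton])
        (auto simp: sets_uniform_count_measure)
    finally show ?thesis .
  qed
  have NinG: "Nin \<omega> \<in> G \<longleftrightarrow> Nin \<omega> b = N" "Nin \<omega> \<in> space ?U" if "\<omega> \<in> space M" for \<omega>
    using measurable_space[OF Nin that] sets_eq_imp_space_eq[OF setsU] by (auto simp: G_def)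
  have epsL: "eps \<omega> \<in> space ?L" if "\<omega> \<in> space M" for \<omega>
    using measurable_space[OF eps that] sets_eq_imp_space_eq[OF setsL[of ?I]] by simp
  let ?R = "\<lambda>A A'. {e \<in> space ?L. restrict e N \<in> A \<and> restrict e (?I - N) \<in> A'}"
  have R: "?R A A' \<in> sets ?L"
    if "A \<in> sets (PiM N ?D)" "A' \<in> sets (PiM (?I - N) ?D)" for A A'
  proof -
    have "?R A A' = ((\<lambda>e. restrict e N) -` A \<inter> space ?L) \<inter>
        ((\<lambda>e. restrict e (?I - N)) -` A' \<inter> space ?L)"
      by auto
    also have "\<dots> \<in> sets ?L"
      using that NI by (intro sets.Int measurable_sets[OF measurable_restrict_subset]) auto
    finally show ?thesis .
  qed
  \<comment> \<open>One formula with three free events. The three probabilities in the claim arise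
    from it by replacing some of these events by the whole space, which has measure 1.\<close>
  have fac: "measure M {\<omega> \<in> space M. eps \<omega> \<in> ?R A A' \<and> Nin \<omega> \<in> H}
      = measure (PiM N ?D) A * measure (PiM (?I - N) ?D) A' * measure ?U H"
    if "A \<in> sets (PiM N ?D)" "A' \<in> sets (PiM (?I - N) ?D)" "H \<in> sets ?U" for A A' H
    using prod[OF R[OF that(1,2)] that(3)]
      PiM_complementary_restrictions[OF D _ NI that(1,2)] by simp
  have one: "measure (PiM J ?D) (space (PiM J ?D)) = 1" for J
    by (intro prob_space.prob_space prob_space_PiM D)
  have top: "restrict (eps \<omega>) J \<in> space (PiM J ?D)" if "J \<subseteq> ?I" "\<omega> \<in> space M" for J \<omega>
    using epsL[OF that(2)] that(1) by (auto simp: space_PiM)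
  have A: "A \<in> sets (PiM N ?D)" and A': "A' \<in> sets (PiM (?I - N) ?D)"
    using A A' setsL by auto
  have "{\<omega> \<in> space M. Nin \<omega> b = N \<and> restrict (eps \<omega>) N \<in> A \<and> restrict (eps \<omega>) (?I - N) \<in> A'}
      = {\<omega> \<in> space M. eps \<omega> \<in> ?R A A' \<and> Nin \<omega> \<in> G}"
    using NinG epsL by auto
  moreover have "{\<omega> \<in> space M. Nin \<omega> b = N \<and> restrict (eps \<omega>) N \<in> A}
      = {\<omega> \<in> space M. eps \<omega> \<in> ?R A (space (PiM (?I - N) ?D)) \<and> Nin \<omega> \<in> G}"
    using NinG epsL top[of "?I - N"] by auto
  moreover have "{\<omega> \<in> space M. restrict (eps \<omega>) (?I - N) \<in> A'}
      = {\<omega> \<in> space M. eps \<omega> \<in> ?R (space (PiM N ?D)) A' \<and> Nin \<omega> \<in> space ?U}"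
    using NinG epsL top[OF NI] by auto
  ultimately show ?thesis
    using fac[OF A A' G] fac[OF A sets.top G] fac[OF sets.top A' sets.top] one U.prob_space
    by simp
qed

section \<open>Aggregation of p-values with random adjustments\<close>

text \<open>Continuity from below: the events \<open>X x \<le> c - 1/(k+1)\<close> increase to
  \<open>X x < c\<close>. It serves to pass from bounds at all levels \<open>t < 1\<close> to a
  bound on the probability of being strictly below 1.\<close>

lemma (in finite_measure) measure_less_le:
  fixes X :: "'a \<Rightarrow> real"
  assumes [measurable]: "X \<in> borel_measurable M"
    and le: "\<And>t. t < c \<Longrightarrow> measure M {x \<in> space M. X x \<le> t} \<le> w"
  shows "measure M {x \<in> space M. X x < c} \<le> w"
proof -
  define A where "A k = {x \<in> space M. X x \<le> c - inverse (real (Suc k))}" for k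
  have U: "(\<Union>k. A k) = {x \<in> space M. X x < c}"
  proof (intro set_eqI iffI)
    fix x assume x: "x \<in> {x \<in> space M. X x < c}"
    then have "0 < c - X x" by simp
    from reals_Archimedean[OF this] obtain k where "inverse (real (Suc k)) < c - X x" ..
    with x have "x \<in> A k" unfolding A_def by simp
    then show "x \<in> (\<Union>k. A k)" by blast
  next
    fix x assume "x \<in> (\<Union>k. A k)"
    then obtain k where "x \<in> A k" by blast
    moreover have "0 < inverse (real (Suc k))" by simp
    ultimately show "x \<in> {x \<in> space M. X x < c}"
      unfolding A_def by (smt (verit) mem_Collect_eq)
  qed
  have "incseq A"
  proof (rule incseq_SucI)
    fix k
    have "inverse (real (Suc (Suc k))) \<le> inverse (real (Suc k))"
      by (intro le_imp_inverse_le) auto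
    then show "A k \<subseteq> A (Suc k)"
      unfolding A_def by (smt (verit) Collect_mono)
  qed
  moreover have "range A \<subseteq> sets M"
    by (auto simp: A_def)
  ultimately have "(\<lambda>k. measure M (A k)) \<longlonglongrightarrow> measure M (\<Union>k. A k)"
    by (rule finite_Lim_measure_incseq[rotated])
  then have "measure M (\<Union>k. A k) \<le> w"
  proof (rule LIMSEQ_le_const2, intro exI allI impI)
    fix k show "measure M (A k) \<le> w"
      unfolding A_def by (rule le) simp
  qed
  then show ?thesis by (simp add: U)
qed

text \<open>The hypotheses constrain only the marginal laws of the \<open>q b\<close>. Their
  dependence is arbitrary, which is the freedom that \<open>aggregation_property\<close> leaves to
  p-values, so it can be applied to the joint law of the vector \<open>q\<close>.\<close>

lemma aggregation_property_random_adjustment: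
  fixes M :: "'w measure" and q :: "nat \<Rightarrow> 'w \<Rightarrow> real"
  assumes "prob_space M" and A6: "aggregation_property B aggr p \<C>"
    and aggr: "aggregation_procedure B aggr"
    and C: "C \<in> \<C>" "C \<subseteq> {1..p}"
    and q: "\<And>b. b \<in> {1..B} \<Longrightarrow> q b \<in> M \<rightarrow>\<^sub>M restrict_space borel {0..1}"
    and w: "\<And>b. b \<in> {1..B} \<Longrightarrow> 0 \<le> w b \<and> w b \<le> 1"
    and w_empty: "\<And>b. b \<in> {1..B} \<Longrightarrow> C = {} \<Longrightarrow> w b = 0"
    and le: "\<And>b t. b \<in> {1..B} \<Longrightarrow> 0 < t \<Longrightarrow> t < 1 \<Longrightarrow>
      measure M {\<omega> \<in> space M. q b \<omega> \<le> t} \<le> t * w b"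
    and a: "0 \<le> a" "a < 1"
  shows "measure M {\<omega> \<in> space M. aggr (\<lambda>b\<in>{1..B}. q b \<omega>) \<le> a} \<le> a / real B * (\<Sum>b=1..B. w b)"
proof -
  interpret prob_space M by fact
  let ?U = "restrict_space borel {0..1::real}"
  let ?K = "\<Pi>\<^sub>M b\<in>{1..B}. ?U"
  have qb: "q b \<in> borel_measurable M" and q01: "\<omega> \<in> space M \<Longrightarrow> 0 \<le> q b \<omega> \<and> q b \<omega> \<le> 1"
    if "b \<in> {1..B}" for b \<omega>
    using q[OF that] by (auto simp: measurable_restrict_space2_iff)
  have sets_le: "{\<omega> \<in> space M. q b \<omega> \<le> t} \<in> events" if "b \<in> {1..B}" for b t
    using qb[OF that] by measurable
  \<comment> \<open>Level 0 is added to the hypothesis \<open>le\<close>: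
    \<open>P(q \<le> 0)\<close> is at most \<open>P(q \<le> s) \<le> s\<close> for every small
    \<open>s > 0\<close>, hence it is 0.\<close>
  have le': "prob {\<omega> \<in> space M. q b \<omega> \<le> t} \<le> t * w b" if b: "b \<in> {1..B}" and "0 \<le> t" "t < 1" for b t
  proof (cases "t = 0")
    case True
    have "prob {\<omega> \<in> space M. q b \<omega> \<le> 0} \<le> s" if "0 < s" for s
    proof (cases "s < 1")
      case True
      have "prob {\<omega> \<in> space M. q b \<omega> \<le> 0} \<le> prob {\<omega> \<in> space M. q b \<omega> \<le> s}"
        using \<open>0 < s\<close> by (intro finite_measure_mono sets_le[OF b]) auto
      also have "\<dots> \<le> s * w b" by (rule le[OF b that True])
      also have "\<dots> \<le> s" using w[OF b] that by (simp add: mult_left_le)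
      finally show ?thesis .
    next
      case False
      then show ?thesis using prob_le_1 by (meson not_less order_trans)
    qed
    then have "prob {\<omega> \<in> space M. q b \<omega> \<le> 0} \<le> 0"
      by (rule dense_ge)
    then show ?thesis using True by simp
  qed (use le that in auto)
  have less1: "prob {\<omega> \<in> space M. q b \<omega> < 1} \<le> w b" if b: "b \<in> {1..B}" for b
  proof (rule measure_less_le[OF qb[OF b]])
    fix t :: real assume "t < 1"
    show "prob {\<omega> \<in> space M. q b \<omega> \<le> t} \<le> w b"
    proof (cases "0 \<le> t")
      case True
      have "t * w b \<le> w b" using w[OF b] \<open>t < 1\<close> by (simp add: mult_left_le_one_le True)
      then show ?thesis using le'[OF b True \<open>t < 1\<close>] by linarith
    next
      case False
      then have "{\<omega> \<in> space M. q b \<omega> \<le> t} = {}" using q01[OF b] by fastforce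
      then show ?thesis using w[OF b] by (simp only: measure_empty)
    qed
  qed
  define f where "f \<omega> = (\<lambda>b\<in>{1..B}. q b \<omega>)" for \<omega>
  have f: "f \<in> M \<rightarrow>\<^sub>M ?K"
    unfolding f_def by (intro measurable_restrict q)
  \<comment> \<open>\<open>aggregation_property\<close> quantifies over measures on
    \<open>nat \<Rightarrow> real\<close>, so the vector \<open>q\<close> is replaced by its law on
    that type.\<close>
  define Q where "Q = distr M ?K f"
  interpret Q: prob_space Q
    unfolding Q_def by (rule prob_space_distr[OF f])
  have setsQ: "sets Q = sets ?K" and spaceQ: "space Q = space ?K"
    by (auto simp: Q_def)
  have probQ: "measure Q {x \<in> space Q. R x} = prob {\<omega> \<in> space M. R (f \<omega>)}"
    if "{x \<in> space ?K. R x} \<in> sets ?K" for R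
  proof -
    have "f -` {x \<in> space ?K. R x} \<inter> space M = {\<omega> \<in> space M. R (f \<omega>)}"
      using measurable_space[OF f] by auto
    then show ?thesis
      using measure_distr[OF f that] by (simp add: Q_def)
  qed
  have comp: "(\<lambda>x. x b) \<in> ?K \<rightarrow>\<^sub>M ?U" if "b \<in> {1..B}" for b
    using that by (rule measurable_component_singleton)
  have K01: "x \<in> space ?K \<Longrightarrow> b \<in> {1..B} \<Longrightarrow> 0 \<le> x b \<and> x b \<le> 1" for x b
    using measurable_space[OF comp, of b x] by auto
  \<comment> \<open>For \<open>x b = 1\<close> the value is 1 and not \<open>w b\<close>: if
    \<open>q b\<close> is 1 with large probability, the value \<open>w b\<close> would receive too
    much mass for a valid p-value. For \<open>w b = 0\<close> the p-value is 1 and the adjustment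
    below is infinite.\<close>
  define P where "P b x = (if 0 < w b \<and> x b < 1 then x b * w b else 1)" for b :: nat and x :: "nat \<Rightarrow> real"
  define m where "m b = (if w b = 0 then \<infinity> else ereal (1 / w b))" for b
  have PU: "P b \<in> Q \<rightarrow>\<^sub>M ?U" if b: "b \<in> {1..B}" for b
  proof (rule measurable_restrict_space2)
    show "P b \<in> space Q \<rightarrow> {0..1}"
      using K01[OF _ b] w[OF b] by (auto simp: P_def spaceQ mult_le_one)
    have [measurable]: "(\<lambda>x. x b) \<in> borel_measurable ?K"
      using comp[OF b] by (auto simp: measurable_restrict_space2_iff)
    show "P b \<in> borel_measurable Q"
      unfolding P_def Q_def by measurable
  qed
  have P_valid: "measure Q {x \<in> space Q. P b x \<le> c} \<le> c" if b: "b \<in> {1..B}" and c: "c \<in> {0..1}" for b c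
  proof (cases "c = 1")
    case True
    then show ?thesis using Q.prob_le_1 by simp
  next
    case False
    with c have "c < 1" by simp
    have "P b \<in> borel_measurable ?K"
      using PU[OF b] setsQ by (auto simp: measurable_restrict_space2_iff cong: measurable_cong_sets)
    then have "{x \<in> space ?K. P b x \<le> c} \<in> sets ?K" by measurable
    then have eq: "measure Q {x \<in> space Q. P b x \<le> c} = prob {\<omega> \<in> space M. P b (f \<omega>) \<le> c}"
      by (rule probQ)
    have Pf: "P b (f \<omega>) = (if 0 < w b \<and> q b \<omega> < 1 then q b \<omega> * w b else 1)" for \<omega>
      using b by (simp add: P_def f_def)
    show ?thesis
    proof (cases "w b = 0")
      case True
      then show ?thesis unfolding eq using c \<open>c < 1\<close> by (simp add: Pf)
    next
      case False
      with w[OF b] have pos: "0 < w b" by simp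
      show ?thesis
      \<comment> \<open>Below \<open>w b\<close> the level \<open>c / w b\<close> for
        \<open>q b\<close> is less than 1 and \<open>le'\<close> applies. From \<open>w b\<close>
        on, it is enough that \<open>P b \<le> c < 1\<close> forces \<open>q b < 1\<close>, an event
        of probability at most \<open>w b \<le> c\<close>.\<close>
      proof (cases "c < w b")
        case True
        have "prob {\<omega> \<in> space M. P b (f \<omega>) \<le> c} \<le> prob {\<omega> \<in> space M. q b \<omega> \<le> c / w b}"
          using pos \<open>c < 1\<close> by (intro finite_measure_mono sets_le[OF b]) (auto simp: Pf field_simps split: if_splits)
        also have "\<dots> \<le> c / w b * w b"
          using c True pos by (intro le'[OF b]) auto
        finally show ?thesis using eq pos by simp
      next
        case False
        have "prob {\<omega> \<in> space M. P b (f \<omega>) \<le> c} \<le> prob {\<omega> \<in> space M. q b \<omega> < 1}"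
          using \<open>c < 1\<close> qb[OF b] by (intro finite_measure_mono) (auto simp: Pf split: if_splits)
        also have "\<dots> \<le> w b" by (rule less1[OF b])
        finally show ?thesis using eq False by simp
      qed
    qed
  qed
  have m1: "1 \<le> m b" if "b \<in> {1..B}" for b
    using w[OF that] by (auto simp: m_def one_ereal_def field_simps)
  have P_empty: "\<forall>x\<in>space Q. P b x = 1" if "b \<in> {1..B}" "C \<inter> C = {}" for b
    using w_empty[OF that(1)] that(2) by (simp add: P_def)
  \<comment> \<open>All screened sets are taken to be \<open>C\<close> itself, so every indicator is
    1 unless \<open>C\<close> is empty. In the empty case \<open>w_empty\<close> makes both sums
    vanish.\<close>
  have "ereal (measure Q {x \<in> space Q. aggr (\<lambda>b\<in>{1..B}. adj_pvalue (P b x) (m b)) \<le> a})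
      \<le> ereal (a / real B) * (\<Sum>b=1..B. of_bool (C \<inter> C \<noteq> {}) / m b)"
    using A6[unfolded aggregation_property_def, rule_format,
        where S="\<lambda>_. C" and C=C and m=m and Q=Q and P=P and a=a]
      C m1 PU P_empty P_valid a Q.prob_space_axioms by auto
  also have "(\<Sum>b=1..B. of_bool (C \<inter> C \<noteq> {}) / m b) = (\<Sum>b=1..B. ereal (w b))"
    using w_empty by (intro sum.cong) (auto simp: m_def one_ereal_def)
  also have "ereal (a / real B) * (\<Sum>b=1..B. ereal (w b)) = ereal (a / real B * (\<Sum>b=1..B. w b))"
    by simp
  finally have bound: "measure Q {x \<in> space Q. aggr (\<lambda>b\<in>{1..B}. adj_pvalue (P b x) (m b)) \<le> a}
      \<le> a / real B * (\<Sum>b=1..B. w b)"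
    by (simp only: ereal_less_eq)
  \<comment> \<open>\<open>g\<close> describes what adjusting \<open>P b x\<close> by
    \<open>m b\<close> gives back: the coordinate \<open>x b\<close>, except that coordinates with
    \<open>w b = 0\<close> become 1. Since \<open>q b < 1\<close> then has probability 0, the
    exception changes \<open>f\<close> only on a null set.\<close>
  define g where "g x = (\<lambda>b\<in>{1..B}. if w b = 0 then 1 else x b)" for x :: "nat \<Rightarrow> real"
  have g: "g \<in> ?K \<rightarrow>\<^sub>M ?K"
    unfolding g_def using comp
    by (intro measurable_restrict) (auto simp: space_restrict_space)
  have adj: "(\<lambda>b\<in>{1..B}. adj_pvalue (P b x) (m b)) = g x" if x: "x \<in> space Q" for x
  proof -
    have "adj_pvalue (P b x) (m b) = (if w b = 0 then 1 else x b)" if b: "b \<in> {1..B}" for b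
    proof (cases "w b = 0 \<or> x b = 1")
      case True
      then show ?thesis
        using w[OF b] by (auto simp: adj_pvalue_def P_def m_def min_def field_simps)
    next
      case False
      then have "0 < w b" "x b < 1"
        using w[OF b] K01[OF x[unfolded spaceQ] b] by auto
      then show ?thesis
        by (simp add: adj_pvalue_def P_def m_def)
    qed
    then show ?thesis by (auto simp: g_def)
  qed
  have aggrU: "aggr \<in> ?K \<rightarrow>\<^sub>M borel"
    using aggr by (auto simp: aggregation_procedure_def measurable_restrict_space2_iff)
  have meas: "{x \<in> space ?K. aggr x \<le> a} \<in> sets ?K" "{x \<in> space ?K. aggr (g x) \<le> a} \<in> sets ?K"
    using aggrU measurable_compose[OF g aggrU] by measurable
  have "AE \<omega> in M. \<forall>b\<in>{1..B}. w b = 0 \<longrightarrow> q b \<omega> = 1"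
  proof (intro AE_finite_allI finite_atLeastAtMost)
    fix b assume b: "b \<in> {1..B}"
    show "AE \<omega> in M. w b = 0 \<longrightarrow> q b \<omega> = 1"
    proof (cases "w b = 0")
      case True
      have "{\<omega> \<in> space M. q b \<omega> < 1} \<in> events" using qb[OF b] by measurable
      moreover have "prob {\<omega> \<in> space M. q b \<omega> < 1} = 0"
        using less1[OF b] True measure_nonneg by (simp add: order_antisym)
      ultimately have "AE \<omega> in M. \<omega> \<notin> {\<omega> \<in> space M. q b \<omega> < 1}"
        by (simp add: prob_eq_0)
      then show ?thesis
        by (rule AE_mp) (use q01[OF b] in \<open>auto intro!: AE_I2 simp: not_less intro: antisym\<close>)
    qed simp
  qed
  then have "AE \<omega> in M. g (f \<omega>) = f \<omega>"
    by (rule AE_mp) (auto intro!: AE_I2 simp: g_def f_def)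
  then have "AE \<omega> in M. \<omega> \<in> {\<omega> \<in> space M. aggr (f \<omega>) \<le> a} \<longrightarrow>
      \<omega> \<in> {\<omega> \<in> space M. aggr (g (f \<omega>)) \<le> a}"
    by (rule AE_mp) (intro AE_I2, simp)
  moreover have "{\<omega> \<in> space M. aggr (g (f \<omega>)) \<le> a} \<in> events"
    using measurable_compose[OF f measurable_compose[OF g aggrU]] by measurable
  ultimately have "prob {\<omega> \<in> space M. aggr (f \<omega>) \<le> a} \<le> prob {\<omega> \<in> space M. aggr (g (f \<omega>)) \<le> a}"
    by (rule finite_measure_mono_AE)
  also have "\<dots> = measure Q {x \<in> space Q. aggr (g x) \<le> a}"
    by (rule probQ[OF meas(2), symmetric])
  also have "{x \<in> space Q. aggr (g x) \<le> a}
      = {x \<in> space Q. aggr (\<lambda>b\<in>{1..B}. adj_pvalue (P b x) (m b)) \<le> a}"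
    using adj by auto
  finally show ?thesis
    using bound unfolding f_def by linarith
qed

section \<open>Adjusted p-values and the sequential procedure for one realisation\<close>

lemma adj_pvalue_bounds:
  assumes "0 \<le> q" "1 \<le> \<mu>"
  shows "adj_pvalue q \<mu> \<in> {0..1}"
  using assms by (cases \<mu>) (auto simp: adj_pvalue_def)

lemma adj_pvalue_mono:
  assumes "0 \<le> q" "1 \<le> \<mu>" "\<mu> \<le> \<nu>"
  shows "adj_pvalue q \<mu> \<le> adj_pvalue q \<nu>"
  using assms by (cases \<mu>; cases \<nu>) (auto simp: adj_pvalue_def min_def intro: mult_left_mono
    dest: mult_left_mono[of _ _ q])

text \<open>A value below 1 shows that the truncation is inactive and the adjustment finite, so the
  threshold can be divided by the adjustment.\<close>

lemma adj_pvalue_le: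
  assumes "adj_pvalue q \<mu> \<le> t" "t < 1" "1 \<le> \<mu>"
  shows "0 < real_of_ereal (1 / \<mu>)" and "q \<le> t * real_of_ereal (1 / \<mu>)"
  using assms by (cases \<mu>; auto simp: adj_pvalue_def one_ereal_def field_simps min_def split: if_splits)+

text \<open>As long as the rejected collection lies in \<open>F\<close>, its adjustments are at
  least those at \<open>F\<close>, and so are the aggregated values. A cluster outside
  \<open>F\<close> that is accepted at \<open>F\<close> is thus accepted at every step.\<close>

lemma rejected_nat_subset:
  assumes aggr: "aggregation_procedure B aggr"
    and P: "\<And>b C. b \<in> {1..B} \<Longrightarrow> C \<in> \<C> \<Longrightarrow> 0 \<le> P b C"
    and m: "\<And>b C \<R>. b \<in> {1..B} \<Longrightarrow> C \<in> \<C> \<Longrightarrow> \<R> \<subseteq> \<C> \<Longrightarrow> 1 \<le> m b C \<R>"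
    and mono: "\<And>b C \<R> \<S>. b \<in> {1..B} \<Longrightarrow> C \<in> \<C> \<Longrightarrow> \<R> \<subseteq> \<S> \<Longrightarrow> \<S> \<subseteq> \<C> \<Longrightarrow> m b C \<S> \<le> m b C \<R>"
    and F: "F \<subseteq> \<C>"
    and accepted: "\<And>C. C \<in> \<C> - F \<Longrightarrow> \<alpha> < aggr (\<lambda>b\<in>{1..B}. adj_pvalue (P b C) (m b C F))"
  shows "rejected_nat B aggr \<alpha> \<C> P m k \<subseteq> F"
proof (induction k)
  case (Suc k)
  let ?R = "rejected_nat B aggr \<alpha> \<C> P m k"
  have "C \<in> F" if C: "C \<in> \<C> - ?R"
    and le: "aggr (\<lambda>b\<in>{1..B}. adj_pvalue (P b C) (m b C ?R)) \<le> \<alpha>" for C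
  proof (rule ccontr)
    assume "C \<notin> F"
    have "aggr (\<lambda>b\<in>{1..B}. adj_pvalue (P b C) (m b C F)) \<le> aggr (\<lambda>b\<in>{1..B}. adj_pvalue (P b C) (m b C ?R))"
    \<comment> \<open>\<open>aggr\<close> is monotone only on the cube, so both vectors of adjusted
      p-values must first be placed there.\<close>
    proof (rule mono_onD[where f=aggr and A="\<Pi>\<^sub>E b\<in>{1..B}. {0..1}"])
      show "mono_on (\<Pi>\<^sub>E b\<in>{1..B}. {0..1}) aggr"
        using aggr by (simp add: aggregation_procedure_def)
      show "(\<lambda>b\<in>{1..B}. adj_pvalue (P b C) (m b C F)) \<in> (\<Pi>\<^sub>E b\<in>{1..B}. {0..1})"
        "(\<lambda>b\<in>{1..B}. adj_pvalue (P b C) (m b C ?R)) \<in> (\<Pi>\<^sub>E b\<in>{1..B}. {0..1})"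
        using C F Suc.IH P m by (auto intro!: PiE_I adj_pvalue_bounds simp del: atLeastAtMost_iff)
    next
      show "(\<lambda>b\<in>{1..B}. adj_pvalue (P b C) (m b C F)) \<le> (\<lambda>b\<in>{1..B}. adj_pvalue (P b C) (m b C ?R))"
        using C F Suc.IH P m mono
        by (auto simp: le_fun_def restrict_def intro!: adj_pvalue_mono simp del: atLeastAtMost_iff)
    qed
    then show False using accepted[of C] C \<open>C \<notin> F\<close> le by auto
  qed
  then show ?case using Suc.IH by (auto simp: successor_def)
qed simp

section \<open>The multi-split model and its measurability\<close>

locale multisplit = prob_space M
  for M :: "'w measure" and n p B :: nat and X :: "nat \<Rightarrow> nat \<Rightarrow> real"
    and \<beta> :: "nat \<Rightarrow> real" and \<sigma> :: real and \<C> :: "nat set set"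
    and eps :: "'w \<Rightarrow> nat \<Rightarrow> real" and Nin :: "'w \<Rightarrow> nat \<Rightarrow> nat set" and Y :: "'w \<Rightarrow> nat \<Rightarrow> real"
    and scr :: "nat \<Rightarrow> nat set \<Rightarrow> (nat \<Rightarrow> real) \<Rightarrow> nat set"
    and test :: "nat \<Rightarrow> nat set \<Rightarrow> nat set \<Rightarrow> nat set \<Rightarrow> (nat \<Rightarrow> real) \<Rightarrow> real"
    and m :: "nat \<Rightarrow> nat set \<Rightarrow> nat set \<Rightarrow> nat set set \<Rightarrow> ereal"
    and aggr :: "(nat \<Rightarrow> real) \<Rightarrow> real"
    and Shat :: "nat \<Rightarrow> 'w \<Rightarrow> nat set" and pval :: "nat \<Rightarrow> nat set \<Rightarrow> 'w \<Rightarrow> real" +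
  assumes \<sigma>: "0 < \<sigma>"
    and clusters: "\<C> \<subseteq> Pow {1..p}"
    and eps: "eps \<in> M \<rightarrow>\<^sub>M (\<Pi>\<^sub>M k\<in>{1..n}. borel)"
    and Nin: "Nin \<in> M \<rightarrow>\<^sub>M (\<Pi>\<^sub>M b\<in>{1..B}. count_space (splits n))"
    and law: "distr M ((\<Pi>\<^sub>M k\<in>{1..n}. borel) \<Otimes>\<^sub>M (\<Pi>\<^sub>M b\<in>{1..B}. count_space (splits n)))
        (\<lambda>\<omega>. (eps \<omega>, Nin \<omega>)) = noise_split_law n \<sigma> B"
    and Y: "Y = (\<lambda>\<omega>. responses n p X \<beta> (eps \<omega>))"
    and scr: "\<And>b N. b \<in> {1..B} \<Longrightarrow> N \<in> splits n \<Longrightarrow>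
        scr b N \<in> (\<Pi>\<^sub>M k\<in>N. borel) \<rightarrow>\<^sub>M count_space (Pow {1..p})"
    and test: "\<And>b C S N. b \<in> {1..B} \<Longrightarrow> C \<in> \<C> \<Longrightarrow> S \<subseteq> {1..p} \<Longrightarrow> N \<in> splits n \<Longrightarrow>
        test b C S ({1..n} - N) \<in> (\<Pi>\<^sub>M k\<in>{1..n} - N. borel) \<rightarrow>\<^sub>M restrict_space borel {0..1}"
    and Shat: "Shat = (\<lambda>b \<omega>. screened_set (scr b) (Nin \<omega> b) (Y \<omega>))"
    and pval: "pval = (\<lambda>b C \<omega>. split_pvalue n (test b) C (Shat b \<omega>) (Nin \<omega> b) (Y \<omega>))"
    and m: "\<And>b S C \<R>. b \<in> {1..B} \<Longrightarrow> S \<subseteq> {1..p} \<Longrightarrow> C \<in> \<C> \<Longrightarrow> \<R> \<subseteq> \<C> \<Longrightarrow> 1 \<le> m b S C \<R>"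
    and aggr: "aggregation_procedure B aggr"
    and correct_testing: "\<And>b C N y a. b \<in> {1..B} \<Longrightarrow> C \<in> \<C> \<Longrightarrow> N \<in> splits n \<Longrightarrow>
        null_hyp \<beta> (C \<inter> screened_set (scr b) N y) \<Longrightarrow> 0 < a \<Longrightarrow> a < 1 \<Longrightarrow>
        measure M {\<omega> \<in> space M.
          split_pvalue n (test b) C (screened_set (scr b) N y) N (Y \<omega>) \<le> a} \<le> a"
begin

lemma finite_clusters: "finite \<C>"
  using clusters finite_subset by blast

text \<open>The responses on \<open>J\<close> as a function of the noise on the same
  \<open>J\<close>. It transfers events about a half-sample of \<open>Y\<close> to events about the
  noise, where independence is available.\<close>

definition shift :: "nat set \<Rightarrow> (nat \<Rightarrow> real) \<Rightarrow> nat \<Rightarrow> real"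
  where "shift J e = (\<lambda>i\<in>J. (\<Sum>j=1..p. X i j * \<beta> j) + e i)"

lemma shift_measurable [measurable]: "shift J \<in> (\<Pi>\<^sub>M k\<in>J. borel) \<rightarrow>\<^sub>M (\<Pi>\<^sub>M k\<in>J. borel)"
  unfolding shift_def
  by (intro measurable_restrict borel_measurable_add borel_measurable_const measurable_component_singleton)

lemma restrict_Y: "J \<subseteq> {1..n} \<Longrightarrow> restrict (Y \<omega>) J = shift J (restrict (eps \<omega>) J)"
  by (auto simp: Y responses_def shift_def fun_eq_iff)

lemma restrict_eps_measurable: "J \<subseteq> {1..n} \<Longrightarrow> (\<lambda>\<omega>. restrict (eps \<omega>) J) \<in> M \<rightarrow>\<^sub>M (\<Pi>\<^sub>M k\<in>J. borel)"
  using measurable_compose[OF eps measurable_restrict_subset] by auto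

lemma restrict_Y_measurable:
  assumes "J \<subseteq> {1..n}"
  shows "(\<lambda>\<omega>. restrict (Y \<omega>) J) \<in> M \<rightarrow>\<^sub>M (\<Pi>\<^sub>M k\<in>J. borel)"
  unfolding restrict_Y[OF assms]
  by (rule measurable_compose[OF restrict_eps_measurable[OF assms] shift_measurable])

lemma Nin_measurable: "b \<in> {1..B} \<Longrightarrow> (\<lambda>\<omega>. Nin \<omega> b) \<in> M \<rightarrow>\<^sub>M count_space (splits n)"
  using measurable_compose[OF Nin measurable_component_singleton] by auto

lemma splits_subset: "N \<in> splits n \<Longrightarrow> N \<subseteq> {1..n}"
  by (simp add: splits_def)

text \<open>The half-sample passed to \<open>scr\<close> is itself random, but it takes finitely
  many values, so measurability can be checked for each fixed split.\<close>

lemma Shat_measurable: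
  assumes b: "b \<in> {1..B}"
  shows "Shat b \<in> M \<rightarrow>\<^sub>M count_space (Pow {1..p})"
proof -
  have "(\<lambda>\<omega>. scr b (Nin \<omega> b) (restrict (Y \<omega>) (Nin \<omega> b))) \<in> M \<rightarrow>\<^sub>M count_space (Pow {1..p})"
  proof (rule measurable_compose_countable'[OF _ Nin_measurable[OF b]])
    fix N assume N: "N \<in> splits n"
    show "(\<lambda>\<omega>. scr b N (restrict (Y \<omega>) N)) \<in> M \<rightarrow>\<^sub>M count_space (Pow {1..p})"
      by (rule measurable_compose[OF restrict_Y_measurable[OF splits_subset[OF N]] scr[OF b N]])
  qed (simp add: countable_finite finite_splits)
  then show ?thesis
    by (simp add: Shat screened_set_def[abs_def])
qed

lemma Shat_subset: "b \<in> {1..B} \<Longrightarrow> \<omega> \<in> space M \<Longrightarrow> Shat b \<omega> \<subseteq> {1..p}"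
  using measurable_space[OF Shat_measurable] by auto

lemma split_pvalue_measurable:
  assumes "b \<in> {1..B}" "C \<in> \<C>" "S \<subseteq> {1..p}" "N \<in> splits n"
  shows "(\<lambda>\<omega>. split_pvalue n (test b) C S N (Y \<omega>)) \<in> M \<rightarrow>\<^sub>M restrict_space borel {0..1}"
proof (cases "C \<inter> S = {}")
  case False
  then show ?thesis
    using measurable_compose[OF restrict_Y_measurable test[OF assms]] by (simp add: split_pvalue_def)
qed (simp add: split_pvalue_def space_restrict_space)

definition adjusted :: "nat \<Rightarrow> nat set \<Rightarrow> nat set set \<Rightarrow> 'w \<Rightarrow> real"
  where "adjusted b C \<R> \<omega> = adj_pvalue (pval b C \<omega>) (m b (Shat b \<omega>) C \<R>)"

lemma adjusted_eq: "adjusted b C \<R> \<omega> =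
  adj_pvalue (split_pvalue n (test b) C (Shat b \<omega>) (Nin \<omega> b) (Y \<omega>)) (m b (Shat b \<omega>) C \<R>)"
proof -
  have "pval b C \<omega> = split_pvalue n (test b) C (Shat b \<omega>) (Nin \<omega> b) (Y \<omega>)"
    by (simp add: pval)
  then show ?thesis by (simp add: adjusted_def)
qed

lemma adj_pvalue_measurable:
  assumes "P \<in> M \<rightarrow>\<^sub>M restrict_space borel {0..1}" "1 \<le> \<mu>"
  shows "(\<lambda>\<omega>. adj_pvalue (P \<omega>) \<mu>) \<in> M \<rightarrow>\<^sub>M restrict_space borel {0..1}"
proof -
  have [measurable]: "P \<in> borel_measurable M" and "P \<in> space M \<rightarrow> {0..1}"
    using assms(1) by (auto simp: measurable_restrict_space2_iff)
  then show ?thesis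
    using adj_pvalue_bounds[OF _ assms(2)]
    by (intro measurable_restrict_space2) (force simp: adj_pvalue_def Pi_iff)+
qed

lemma pval_measurable:
  assumes b: "b \<in> {1..B}" and C: "C \<in> \<C>" and \<R>: "\<R> \<subseteq> \<C>"
  shows "pval b C \<in> M \<rightarrow>\<^sub>M restrict_space borel {0..1}"
    and "adjusted b C \<R> \<in> M \<rightarrow>\<^sub>M restrict_space borel {0..1}"
proof -
  \<comment> \<open>Once the split and the screened set are both fixed, the test and the adjustment
    are fixed as well, and this pair ranges over a finite set.\<close>
  have pair: "(\<lambda>\<omega>. (Nin \<omega> b, Shat b \<omega>)) \<in> M \<rightarrow>\<^sub>M count_space (splits n \<times> Pow {1..p})"
    using measurable_Pair[OF Nin_measurable[OF b] Shat_measurable[OF b]]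
    by (simp add: pair_measure_count_space countable_finite finite_splits)
  have count: "countable (splits n \<times> Pow {1..p})"
    by (simp add: countable_finite finite_splits)
  have "(\<lambda>\<omega>. case (Nin \<omega> b, Shat b \<omega>) of (N, S) \<Rightarrow> split_pvalue n (test b) C S N (Y \<omega>))
      \<in> M \<rightarrow>\<^sub>M restrict_space borel {0..1}"
    by (rule measurable_compose_countable'[OF _ pair count]) (use split_pvalue_measurable[OF b C] in auto)
  then show "pval b C \<in> M \<rightarrow>\<^sub>M restrict_space borel {0..1}"
    by (simp add: pval)
  have "(\<lambda>\<omega>. case (Nin \<omega> b, Shat b \<omega>) of (N, S) \<Rightarrow>
        adj_pvalue (split_pvalue n (test b) C S N (Y \<omega>)) (m b S C \<R>))
      \<in> M \<rightarrow>\<^sub>M restrict_space borel {0..1}"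
    by (rule measurable_compose_countable'[OF _ pair count])
      (use adj_pvalue_measurable[OF split_pvalue_measurable[OF b C] m[OF b _ C \<R>]] in auto)
  then show "adjusted b C \<R> \<in> M \<rightarrow>\<^sub>M restrict_space borel {0..1}"
    by (simp add: adjusted_eq[abs_def])
qed

lemma aggregated_sets:
  assumes C: "C \<in> \<C>" and \<R>: "\<R> \<subseteq> \<C>"
  shows "{\<omega> \<in> space M. aggr (\<lambda>b\<in>{1..B}. adjusted b C \<R> \<omega>) \<le> t} \<in> events"
proof -
  have "aggr \<in> (\<Pi>\<^sub>M b\<in>{1..B}. restrict_space borel {0..1}) \<rightarrow>\<^sub>M borel"
    using aggr by (auto simp: aggregation_procedure_def measurable_restrict_space2_iff)
  moreover have "(\<lambda>\<omega>. \<lambda>b\<in>{1..B}. adjusted b C \<R> \<omega>)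
      \<in> M \<rightarrow>\<^sub>M (\<Pi>\<^sub>M b\<in>{1..B}. restrict_space borel {0..1})"
    by (intro measurable_restrict pval_measurable C \<R>)
  ultimately have "(\<lambda>\<omega>. aggr (\<lambda>b\<in>{1..B}. adjusted b C \<R> \<omega>)) \<in> borel_measurable M"
    by (rule measurable_compose[rotated])
  then show ?thesis by measurable
qed

section \<open>Validity of the p-values given split and screened set\<close>

lemma true_null:
  assumes "C \<in> \<C> - false_nulls p \<beta> \<C>"
  shows "null_hyp \<beta> (C \<inter> S)"
proof -
  have "C \<subseteq> {1..p}" and "C \<inter> active_set p \<beta> = {}"
    using assms clusters by (auto simp: false_nulls_def)
  then show ?thesis
    unfolding null_hyp_def active_set_def by blast
qed

text \<open>The second half-sample is independent of the split and of the first half-sample, so the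
  p-value of a true null remains valid given the split and the screened set.\<close>

lemma prob_split_screened_pvalue_le:
  assumes b: "b \<in> {1..B}" and C: "C \<in> \<C> - false_nulls p \<beta> \<C>"
    and N: "N \<in> splits n" and S: "S \<subseteq> {1..p}" "C \<inter> S \<noteq> {}" and a: "0 < a" "a < 1"
  shows "prob {\<omega> \<in> space M. Nin \<omega> b = N \<and> Shat b \<omega> = S \<and> split_pvalue n (test b) C S N (Y \<omega>) \<le> a}
    \<le> a * prob {\<omega> \<in> space M. Nin \<omega> b = N \<and> Shat b \<omega> = S}"
\<comment> \<open>Correct testing is assumed for sets that the screening can return on
  \<open>N\<close>. For any other \<open>S\<close> the event is empty.\<close>
proof (cases "\<exists>y. S = screened_set (scr b) N y")
  case True
  then obtain y where y: "S = screened_set (scr b) N y" by blast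
  let ?J = "{1..n} - N"
  let ?KN = "\<Pi>\<^sub>M k\<in>N. (borel :: real measure)" and ?KJ = "\<Pi>\<^sub>M k\<in>?J. (borel :: real measure)"
  \<comment> \<open>\<open>A\<close> and \<open>A'\<close> express "screening returns
    \<open>S\<close>" and "the p-value is at most \<open>a\<close>" through the noise on
    \<open>N\<close> and on its complement.\<close>
  define A where "A = (\<lambda>e. scr b N (shift N e)) -` {S} \<inter> space ?KN"
  define A' where "A' = (\<lambda>e. test b C S ?J (shift ?J e)) -` {..a} \<inter> space ?KJ"
  have N': "N \<subseteq> {1..n}" "?J \<subseteq> {1..n}" using splits_subset[OF N] by auto
  have C': "C \<in> \<C>" using C by simp
  have A: "A \<in> sets ?KN"
    unfolding A_def using S
    by (intro measurable_sets[OF measurable_compose[OF shift_measurable scr[OF b N]]]) auto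
  have "test b C S ?J \<in> ?KJ \<rightarrow>\<^sub>M borel"
    using test[OF b C' S(1) N] by (auto simp: measurable_restrict_space2_iff)
  then have A': "A' \<in> sets ?KJ"
    unfolding A'_def by (intro measurable_sets[OF measurable_compose[OF shift_measurable]]) auto
  have inA: "restrict (eps \<omega>) N \<in> A \<longleftrightarrow> scr b N (restrict (Y \<omega>) N) = S"
    and inA': "restrict (eps \<omega>) ?J \<in> A' \<longleftrightarrow> split_pvalue n (test b) C S N (Y \<omega>) \<le> a"
    if "\<omega> \<in> space M" for \<omega>
    using measurable_space[OF restrict_eps_measurable[OF N'(1)] that]
      measurable_space[OF restrict_eps_measurable[OF N'(2)] that] S
    unfolding restrict_Y[OF N'(1)] restrict_Y[OF N'(2)] split_pvalue_def
    by (simp_all add: A_def A'_def)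
  have Shat_N: "Nin \<omega> b = N \<Longrightarrow> Shat b \<omega> = scr b N (restrict (Y \<omega>) N)" for \<omega>
    by (simp add: Shat screened_set_def)
  have "prob {\<omega> \<in> space M. restrict (eps \<omega>) ?J \<in> A'}
      = prob {\<omega> \<in> space M. split_pvalue n (test b) C S N (Y \<omega>) \<le> a}"
    using inA' by (intro arg_cong[where f=prob]) auto
  also have "\<dots> \<le> a"
    unfolding y by (rule correct_testing[OF b C' N true_null[OF C] a])
  finally have le: "prob {\<omega> \<in> space M. restrict (eps \<omega>) ?J \<in> A'} \<le> a" .
  have "prob {\<omega> \<in> space M. Nin \<omega> b = N \<and> Shat b \<omega> = S \<and> split_pvalue n (test b) C S N (Y \<omega>) \<le> a}
      = prob {\<omega> \<in> space M. Nin \<omega> b = N \<and> restrict (eps \<omega>) N \<in> A \<and> restrict (eps \<omega>) ?J \<in> A'}"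
    using inA inA' Shat_N by (intro arg_cong[where f=prob]) auto
  also have "\<dots> = prob {\<omega> \<in> space M. Nin \<omega> b = N \<and> restrict (eps \<omega>) N \<in> A} *
      prob {\<omega> \<in> space M. restrict (eps \<omega>) ?J \<in> A'}"
    by (rule noise_split_law_factorization[OF \<sigma> eps Nin law b N A A'])
  also have "\<dots> \<le> prob {\<omega> \<in> space M. Nin \<omega> b = N \<and> restrict (eps \<omega>) N \<in> A} * a"
    by (intro mult_left_mono le) simp
  also have "{\<omega> \<in> space M. Nin \<omega> b = N \<and> restrict (eps \<omega>) N \<in> A}
      = {\<omega> \<in> space M. Nin \<omega> b = N \<and> Shat b \<omega> = S}"
    using inA Shat_N by auto
  finally show ?thesis by (simp add: mult.commute)
next
  case False
  then have "{\<omega> \<in> space M. Nin \<omega> b = N \<and> Shat b \<omega> = S \<and> split_pvalue n (test b) C S N (Y \<omega>) \<le> a} = {}"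
    by (auto simp: Shat)
  then show ?thesis using a by (simp only: measure_empty) simp
qed

section \<open>Inverse adjustments and the law of an adjusted p-value\<close>

text \<open>The summand of the single-step property, made real so that it can be integrated. For
  adjustments of at least 1 the quotient lies between 0 and 1, so the conversion loses
  nothing.\<close>

definition inverse_adjustment :: "nat \<Rightarrow> nat set \<Rightarrow> nat set set \<Rightarrow> nat set \<Rightarrow> real"
  where "inverse_adjustment b C \<R> S = real_of_ereal (of_bool (C \<inter> S \<noteq> {}) / m b S C \<R>)"

lemma ereal_inverse_adjustment:
  assumes "b \<in> {1..B}" "S \<subseteq> {1..p}" "C \<in> \<C>" "\<R> \<subseteq> \<C>"
  shows "ereal (inverse_adjustment b C \<R> S) = of_bool (C \<inter> S \<noteq> {}) / m b S C \<R>"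
  using m[OF assms] by (cases "m b S C \<R>") (auto simp: inverse_adjustment_def one_ereal_def)

lemma inverse_adjustment_bounds:
  assumes "b \<in> {1..B}" "S \<subseteq> {1..p}" "C \<in> \<C>" "\<R> \<subseteq> \<C>"
  shows "0 \<le> inverse_adjustment b C \<R> S" "inverse_adjustment b C \<R> S \<le> 1"
  using m[OF assms] by (cases "m b S C \<R>"; auto simp: inverse_adjustment_def one_ereal_def field_simps)+

lemma inverse_adjustment_measurable:
  assumes "b \<in> {1..B}"
  shows "(\<lambda>\<omega>. inverse_adjustment b C \<R> (Shat b \<omega>)) \<in> borel_measurable M"
  by (rule measurable_compose[OF Shat_measurable[OF assms]]) simp

lemma inverse_adjustment_integrable:
  assumes b: "b \<in> {1..B}" and "C \<in> \<C>" "\<R> \<subseteq> \<C>"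
  shows "integrable M (\<lambda>\<omega>. inverse_adjustment b C \<R> (Shat b \<omega>))"
proof (rule integrable_const_bound[where B=1])
  show "AE \<omega> in M. norm (inverse_adjustment b C \<R> (Shat b \<omega>)) \<le> 1"
    using inverse_adjustment_bounds[OF b Shat_subset[OF b] assms(2,3)] by (intro AE_I2) simp
qed (rule inverse_adjustment_measurable[OF b])

lemma split_screened_sets:
  assumes "b \<in> {1..B}"
  shows "{\<omega> \<in> space M. Nin \<omega> b = N \<and> Shat b \<omega> = S} \<in> events"
proof (cases "N \<in> splits n \<and> S \<subseteq> {1..p}")
  case True
  have "{\<omega> \<in> space M. Nin \<omega> b = N \<and> Shat b \<omega> = S}
      = ((\<lambda>\<omega>. Nin \<omega> b) -` {N} \<inter> space M) \<inter> (Shat b -` {S} \<inter> space M)"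
    by auto
  also have "\<dots> \<in> events"
    using True Nin_measurable[OF assms] Shat_measurable[OF assms]
    by (intro sets.Int measurable_sets) auto
  finally show ?thesis .
next
  case False
  then have "{\<omega> \<in> space M. Nin \<omega> b = N \<and> Shat b \<omega> = S} = {}"
    using measurable_space[OF Nin_measurable[OF assms]] Shat_subset[OF assms] by auto
  then show ?thesis by (simp only: sets.empty_sets)
qed

text \<open>On each of the finitely many cells given by a split and a screened set \<open>S\<close>,
  being at most \<open>t\<close> after adjustment means that the p-value is at most the constant
  \<open>t * inverse_adjustment b C \<R> S\<close>. Validity within the cell bounds its
  contribution, and summing over the cells produces the expectation.\<close>

lemma prob_adjusted_le:
  assumes b: "b \<in> {1..B}" and C: "C \<in> \<C> - false_nulls p \<beta> \<C>" and \<R>: "\<R> \<subseteq> \<C>"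
    and t: "0 < t" "t < 1"
  shows "prob {\<omega> \<in> space M. adjusted b C \<R> \<omega> \<le> t}
    \<le> t * expectation (\<lambda>\<omega>. inverse_adjustment b C \<R> (Shat b \<omega>))"
proof -
  define I where "I = splits n \<times> Pow {1..p}"
  define D where "D = (\<lambda>(N, S). {\<omega> \<in> space M. Nin \<omega> b = N \<and> Shat b \<omega> = S})"
  let ?h = "inverse_adjustment b C \<R>"
  let ?A = "{\<omega> \<in> space M. adjusted b C \<R> \<omega> \<le> t}"
  have C': "C \<in> \<C>" using C by simp
  have finI: "finite I"
    by (simp add: I_def finite_splits)
  have D: "D i \<in> events" for i
    using split_screened_sets[OF b] by (cases i) (simp add: D_def)
  have A: "?A \<in> events"
    using pval_measurable(2)[OF b C' \<R>] by (auto simp: measurable_restrict_space2_iff)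
  have cover: "(Nin \<omega> b, Shat b \<omega>) \<in> I" if "\<omega> \<in> space M" for \<omega>
    using measurable_space[OF Nin_measurable[OF b] that] Shat_subset[OF b that] by (simp add: I_def)
  have le: "prob (?A \<inter> D i) \<le> t * (?h (snd i) * prob (D i))" if i: "i \<in> I" for i
  proof -
    obtain N S where i: "i = (N, S)" and N: "N \<in> splits n" and S: "S \<subseteq> {1..p}"
      using i unfolding I_def by blast
    note h = inverse_adjustment_bounds[OF b S C' \<R>]
    \<comment> \<open>If \<open>C\<close> misses \<open>S\<close>, the p-value is 1, hence the
      adjusted value is 1 and exceeds \<open>t\<close>.\<close>
    have pos: "C \<inter> S \<noteq> {}" "0 < ?h S" "split_pvalue n (test b) C S N (Y \<omega>) \<le> t * ?h S"
      if \<omega>: "\<omega> \<in> ?A \<inter> D i" for \<omega>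
    proof -
      have le: "adj_pvalue (split_pvalue n (test b) C S N (Y \<omega>)) (m b S C \<R>) \<le> t"
        using \<omega> by (auto simp: D_def i adjusted_eq)
      note bounds = adj_pvalue_le[OF le t(2) m[OF b S C' \<R>]]
      show CS: "C \<inter> S \<noteq> {}"
      proof
        assume "C \<inter> S = {}"
        then have "adj_pvalue (split_pvalue n (test b) C S N (Y \<omega>)) (m b S C \<R>) = 1"
          using m[OF b S C' \<R>] by (cases "m b S C \<R>") (auto simp: split_pvalue_def adj_pvalue_def)
        then show False using le t by simp
      qed
      show "0 < ?h S" "split_pvalue n (test b) C S N (Y \<omega>) \<le> t * ?h S"
        using bounds CS by (simp_all add: inverse_adjustment_def)
    qed
    show ?thesis
    \<comment> \<open>Validity within a cell needs a strictly positive threshold. Any point of the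
      event supplies one, by \<open>pos\<close>.\<close>
    proof (cases "?A \<inter> D i = {}")
      case True
      then show ?thesis using h(1) t by (simp add: i)
    next
      case False
      then have CS: "C \<inter> S \<noteq> {}" and hS: "0 < ?h S" using pos by auto
      have th: "0 < t * ?h S" "t * ?h S < 1"
        using hS h(2) t le_less_trans[OF mult_left_le t(2)] by auto
      have "split_pvalue n (test b) C S N \<circ> Y \<in> borel_measurable M"
        using split_pvalue_measurable[OF b C' S N] by (auto simp: measurable_restrict_space2_iff comp_def)
      then have "{\<omega> \<in> space M. (split_pvalue n (test b) C S N \<circ> Y) \<omega> \<le> t * ?h S} \<in> events"
        by measurable
      then have ev: "D i \<inter> {\<omega> \<in> space M. split_pvalue n (test b) C S N (Y \<omega>) \<le> t * ?h S} \<in> events"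
        using D by auto
      have "prob (?A \<inter> D i) \<le> prob (D i \<inter> {\<omega> \<in> space M. split_pvalue n (test b) C S N (Y \<omega>) \<le> t * ?h S})"
        using pos(3) by (intro finite_measure_mono ev) auto
      also have "D i \<inter> {\<omega> \<in> space M. split_pvalue n (test b) C S N (Y \<omega>) \<le> t * ?h S}
          = {\<omega> \<in> space M. Nin \<omega> b = N \<and> Shat b \<omega> = S \<and> split_pvalue n (test b) C S N (Y \<omega>) \<le> t * ?h S}"
        by (auto simp: D_def i)
      also have "prob \<dots> \<le> (t * ?h S) * prob {\<omega> \<in> space M. Nin \<omega> b = N \<and> Shat b \<omega> = S}"
        by (rule prob_split_screened_pvalue_le[OF b C N S CS th])
      finally show ?thesis by (simp add: i D_def mult.assoc)
    qed
  qed
  have "?A \<subseteq> (\<Union>i\<in>I. ?A \<inter> D i)"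
    using cover by (fastforce simp: D_def)
  then have "prob ?A \<le> prob (\<Union>i\<in>I. ?A \<inter> D i)"
    by (intro finite_measure_mono sets.finite_UN sets.Int A D finI)
  also have "\<dots> \<le> (\<Sum>i\<in>I. prob (?A \<inter> D i))"
    using A D by (intro finite_measure_subadditive_finite finI) auto
  also have "\<dots> \<le> (\<Sum>i\<in>I. t * (?h (snd i) * prob (D i)))"
    by (intro sum_mono le)
  also have "\<dots> = t * (\<Sum>i\<in>I. expectation (\<lambda>\<omega>. ?h (snd i) * indicator (D i) \<omega>))"
    using D by (simp add: sum_distrib_left)
  \<comment> \<open>At each \<open>\<omega>\<close> exactly one cell indicator is nonzero, namely
    that of the realised split and screened set.\<close>
  also have "(\<Sum>i\<in>I. expectation (\<lambda>\<omega>. ?h (snd i) * indicator (D i) \<omega>))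
      = expectation (\<lambda>\<omega>. \<Sum>i\<in>I. ?h (snd i) * indicator (D i) \<omega>)"
    using D by (intro Bochner_Integration.integral_sum[symmetric] integrable_mult_right
        integrable_real_indicator) (auto simp: emeasure_eq_measure)
  also have "\<dots> = expectation (\<lambda>\<omega>. ?h (Shat b \<omega>))"
  proof (intro Bochner_Integration.integral_cong refl)
    fix \<omega> assume \<omega>: "\<omega> \<in> space M"
    have "(\<Sum>i\<in>I. ?h (snd i) * indicator (D i) \<omega>)
        = (\<Sum>i\<in>I. if i = (Nin \<omega> b, Shat b \<omega>) then ?h (Shat b \<omega>) else 0)"
      using \<omega> by (intro sum.cong) (auto simp: D_def indicator_def)
    also have "\<dots> = ?h (Shat b \<omega>)"
      using cover[OF \<omega>] finI by simp
    finally show "(\<Sum>i\<in>I. ?h (snd i) * indicator (D i) \<omega>) = ?h (Shat b \<omega>)" .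
  qed
  finally show ?thesis .
qed

section \<open>Union bound over the true null hypotheses\<close>

text \<open>The bounds for the individual clusters are averages over the splits of expected inverse
  adjustments. Added over the true nulls, these expectations are at most 1 for each split, so their
  average over the splits is too.\<close>

lemma prob_false_rejection_le:
  assumes B: "1 \<le> B" and \<alpha>: "0 < \<alpha>" "\<alpha> < 1" and \<R>: "\<R> \<subseteq> \<C>"
    and single_step: "\<And>b \<omega>. b \<in> {1..B} \<Longrightarrow> \<omega> \<in> space M \<Longrightarrow>
        (\<Sum>C\<in>\<C> - false_nulls p \<beta> \<C>. of_bool (C \<inter> Shat b \<omega> \<noteq> {}) / m b (Shat b \<omega>) C \<R>) \<le> 1"
    and A6: "aggregation_property B aggr p \<C>"
  shows "prob (\<Union>C\<in>\<C> - false_nulls p \<beta> \<C>.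
    {\<omega> \<in> space M. aggr (\<lambda>b\<in>{1..B}. adjusted b C \<R> \<omega>) \<le> \<alpha>}) \<le> \<alpha>"
proof -
  let ?T = "\<C> - false_nulls p \<beta> \<C>"
  define w where "w C b = expectation (\<lambda>\<omega>. inverse_adjustment b C \<R> (Shat b \<omega>))" for C b
  have fin: "finite ?T" using finite_clusters by simp
  have step: "prob {\<omega> \<in> space M. aggr (\<lambda>b\<in>{1..B}. adjusted b C \<R> \<omega>) \<le> \<alpha>}
      \<le> \<alpha> / real B * (\<Sum>b=1..B. w C b)" if C: "C \<in> ?T" for C
  proof (rule aggregation_property_random_adjustment[OF prob_space_axioms A6 aggr])
    have C': "C \<in> \<C>" using C by simp
    then show "C \<in> \<C>" "C \<subseteq> {1..p}" using clusters by auto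
    fix b assume b: "b \<in> {1..B}"
    show "adjusted b C \<R> \<in> M \<rightarrow>\<^sub>M restrict_space borel {0..1}"
      by (rule pval_measurable(2)[OF b C' \<R>])
    note h = inverse_adjustment_bounds[OF b Shat_subset[OF b] C' \<R>]
    have "0 \<le> w C b"
      unfolding w_def using h by (intro Bochner_Integration.integral_nonneg_AE AE_I2) auto
    moreover have "w C b \<le> expectation (\<lambda>_. 1)"
      unfolding w_def using h
      by (intro integral_mono inverse_adjustment_integrable[OF b C' \<R>]) auto
    ultimately show "0 \<le> w C b \<and> w C b \<le> 1"
      by (simp add: prob_space)
    show "w C b = 0" if "C = {}"
      using that by (simp add: w_def inverse_adjustment_def)
    show "prob {\<omega> \<in> space M. adjusted b C \<R> \<omega> \<le> t} \<le> t * w C b" if "0 < t" "t < 1" for t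
      unfolding w_def by (rule prob_adjusted_le[OF b C \<R> that])
  qed (use \<alpha> in auto)
  \<comment> \<open>The single-step inequality holds at every \<open>\<omega>\<close> and is
    integrated.\<close>
  have total: "(\<Sum>C\<in>?T. w C b) \<le> 1" if b: "b \<in> {1..B}" for b
  proof -
    have "(\<Sum>C\<in>?T. w C b) = expectation (\<lambda>\<omega>. \<Sum>C\<in>?T. inverse_adjustment b C \<R> (Shat b \<omega>))"
      unfolding w_def
      by (intro Bochner_Integration.integral_sum[symmetric] inverse_adjustment_integrable[OF b _ \<R>]) auto
    also have "\<dots> \<le> expectation (\<lambda>_. 1)"
    proof (intro integral_mono Bochner_Integration.integrable_sum inverse_adjustment_integrable[OF b _ \<R>])
      fix \<omega> assume \<omega>: "\<omega> \<in> space M"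
      have "ereal (\<Sum>C\<in>?T. inverse_adjustment b C \<R> (Shat b \<omega>))
          = (\<Sum>C\<in>?T. of_bool (C \<inter> Shat b \<omega> \<noteq> {}) / m b (Shat b \<omega>) C \<R>)"
        using ereal_inverse_adjustment[OF b Shat_subset[OF b \<omega>] _ \<R>]
        by (simp add: sum_ereal[symmetric] del: sum_ereal)
      also have "\<dots> \<le> 1" by (rule single_step[OF b \<omega>])
      finally show "(\<Sum>C\<in>?T. inverse_adjustment b C \<R> (Shat b \<omega>)) \<le> 1"
        by (simp add: one_ereal_def)
    qed auto
    finally show ?thesis by (simp add: prob_space)
  qed
  have "prob (\<Union>C\<in>?T. {\<omega> \<in> space M. aggr (\<lambda>b\<in>{1..B}. adjusted b C \<R> \<omega>) \<le> \<alpha>})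
      \<le> (\<Sum>C\<in>?T. prob {\<omega> \<in> space M. aggr (\<lambda>b\<in>{1..B}. adjusted b C \<R> \<omega>) \<le> \<alpha>})"
    using aggregated_sets[OF _ \<R>] by (intro finite_measure_subadditive_finite fin) auto
  also have "\<dots> \<le> (\<Sum>C\<in>?T. \<alpha> / real B * (\<Sum>b=1..B. w C b))"
    by (intro sum_mono step)
  also have "\<dots> = \<alpha> / real B * (\<Sum>b=1..B. \<Sum>C\<in>?T. w C b)"
    by (subst sum.swap) (simp add: sum_distrib_left)
  also have "\<dots> \<le> \<alpha> / real B * (\<Sum>b=1..B. 1)"
    using \<alpha> total by (intro mult_left_mono sum_mono) auto
  also have "\<dots> = \<alpha>" using B by simp
  finally show ?thesis .
qed

section \<open>Measurability of the rejected collections\<close>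

text \<open>With finitely many clusters the previous collection has finitely many values. For each
  fixed value, the next collection is determined by finitely many threshold events for aggregated
  p-values.\<close>

lemma rejected_nat_measurable:
  "(\<lambda>\<omega>. rejected_nat B aggr \<alpha> \<C> (\<lambda>b C. pval b C \<omega>) (\<lambda>b. m b (Shat b \<omega>)) k)
    \<in> M \<rightarrow>\<^sub>M count_space (Pow \<C>)"
proof (induction k)
  case (Suc k)
  let ?R = "\<lambda>\<omega>. rejected_nat B aggr \<alpha> \<C> (\<lambda>b C. pval b C \<omega>) (\<lambda>b. m b (Shat b \<omega>)) k"
  let ?s = "\<lambda>\<R> \<omega>. \<R> \<union> successor B aggr \<alpha> \<C> (\<lambda>b C. pval b C \<omega>) (\<lambda>b. m b (Shat b \<omega>)) \<R>"
  have "(\<lambda>\<omega>. ?s (?R \<omega>) \<omega>) \<in> M \<rightarrow>\<^sub>M count_space (Pow \<C>)"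
  proof (rule measurable_compose_countable'[OF _ Suc.IH])
    show "countable (Pow \<C>)"
      by (simp add: countable_finite finite_clusters)
    fix \<R> assume "\<R> \<in> Pow \<C>"
    then have \<R>: "\<R> \<subseteq> \<C>" by simp
    have "{\<omega> \<in> space M. ?s \<R> \<omega> = \<S>} \<in> events" if "\<S> \<subseteq> \<C>" for \<S>
    proof -
      have mem: "C \<in> ?s \<R> \<omega> \<longleftrightarrow> C \<in> \<R> \<or> aggr (\<lambda>b\<in>{1..B}. adjusted b C \<R> \<omega>) \<le> \<alpha>" if "C \<in> \<C>" for C \<omega>
        using that by (auto simp: successor_def adjusted_def)
      have "?s \<R> \<omega> \<subseteq> \<C>" for \<omega>
        using \<R> by (auto simp: successor_def)
      \<comment> \<open>Equality of two collections is tested cluster by cluster, which gives a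
        finite Boolean combination of such events.\<close>
      then have "{\<omega> \<in> space M. ?s \<R> \<omega> = \<S>} = {\<omega> \<in> space M. \<forall>C\<in>\<C>. C \<in> ?s \<R> \<omega> \<longleftrightarrow> C \<in> \<S>}"
        using that by blast
      also have "\<dots> = {\<omega> \<in> space M. \<forall>C\<in>\<C>.
          (C \<in> \<R> \<or> aggr (\<lambda>b\<in>{1..B}. adjusted b C \<R> \<omega>) \<le> \<alpha>) \<longleftrightarrow> C \<in> \<S>}"
        using mem by auto
      also have "\<dots> \<in> events"
      proof (rule sets.sets_Collect_finite_All[OF _ finite_clusters])
        fix C assume "C \<in> \<C>"
        from aggregated_sets[OF this \<R>, of \<alpha>]
        show "{\<omega> \<in> space M.
            (C \<in> \<R> \<or> aggr (\<lambda>b\<in>{1..B}. adjusted b C \<R> \<omega>) \<le> \<alpha>) \<longleftrightarrow> C \<in> \<S>} \<in> events"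
          by (cases "C \<in> \<R>"; cases "C \<in> \<S>") (auto dest: sets.sets_Collect_neg)
      qed
      finally show ?thesis .
    qed
    then show "?s \<R> \<in> M \<rightarrow>\<^sub>M count_space (Pow \<C>)"
      using \<R> finite_clusters
      by (subst measurable_count_space_eq2)
        (auto simp: successor_def vimage_def Int_def conj_commute)
  qed
  then show ?case by simp
qed simp

text \<open>Monotonicity of \<open>prob\<close> asks for measurability of the larger event, which in
  the final bound is this one. For the limit, inclusion of the union is a countable
  conjunction.\<close>

lemma rejected_subset_sets:
  "{\<omega> \<in> space M. rejected B aggr \<alpha> \<C> (\<lambda>b C. pval b C \<omega>) (\<lambda>b. m b (Shat b \<omega>)) i \<subseteq> F} \<in> events"
proof -
  let ?R = "\<lambda>k \<omega>. rejected_nat B aggr \<alpha> \<C> (\<lambda>b C. pval b C \<omega>) (\<lambda>b. m b (Shat b \<omega>)) k"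
  have R: "{\<omega> \<in> space M. ?R k \<omega> \<subseteq> F} \<in> events" for k
  proof -
    have "{\<omega> \<in> space M. ?R k \<omega> \<subseteq> F} = ?R k -` (Pow \<C> \<inter> Pow F) \<inter> space M"
      using measurable_space[OF rejected_nat_measurable] by auto
    also have "\<dots> \<in> events"
      by (rule measurable_sets[OF rejected_nat_measurable]) simp
    finally show ?thesis .
  qed
  show ?thesis
  proof (cases i)
    case (enat k)
    then show ?thesis using R by (simp add: rejected_def)
  next
    case infinity
    have "{\<omega> \<in> space M. (\<Union>k. ?R k \<omega>) \<subseteq> F} = {\<omega> \<in> space M. \<forall>k. ?R k \<omega> \<subseteq> F}"
      by auto
    also have "\<dots> \<in> events"
      by (intro sets.sets_Collect_countable_All R)
    finally show ?thesis using infinity by (simp add: rejected_def)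
  qed
qed

end

section \<open>Control of the familywise error\<close>

theorem theorem1:
  fixes M :: "'w measure" and n p B :: nat and X :: "nat \<Rightarrow> nat \<Rightarrow> real"
    and \<beta> :: "nat \<Rightarrow> real" and \<sigma> \<alpha> \<delta> :: real and \<C> :: "nat set set"
    and eps :: "'w \<Rightarrow> nat \<Rightarrow> real" and Nin :: "'w \<Rightarrow> nat \<Rightarrow> nat set" and Y :: "'w \<Rightarrow> nat \<Rightarrow> real"
    and scr :: "nat \<Rightarrow> nat set \<Rightarrow> (nat \<Rightarrow> real) \<Rightarrow> nat set"
    and test :: "nat \<Rightarrow> nat set \<Rightarrow> nat set \<Rightarrow> nat set \<Rightarrow> (nat \<Rightarrow> real) \<Rightarrow> real"
    and m :: "nat \<Rightarrow> nat set \<Rightarrow> nat set \<Rightarrow> nat set set \<Rightarrow> ereal"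
    and aggr :: "(nat \<Rightarrow> real) \<Rightarrow> real"
    and Shat :: "nat \<Rightarrow> 'w \<Rightarrow> nat set" and pval :: "nat \<Rightarrow> nat set \<Rightarrow> 'w \<Rightarrow> real" and i :: enat
  assumes prob: "prob_space M" and B: "1 \<le> B" and \<sigma>: "0 < \<sigma>"
    and clusters: "\<C> \<subseteq> Pow {1..p}"
    and \<alpha>: "0 < \<alpha>" "\<alpha> < 1" and \<delta>: "0 < \<delta>" "\<delta> < 1"
    and eps: "eps \<in> M \<rightarrow>\<^sub>M (\<Pi>\<^sub>M k\<in>{1..n}. borel)"
    and Nin: "Nin \<in> M \<rightarrow>\<^sub>M (\<Pi>\<^sub>M b\<in>{1..B}. count_space (splits n))"
    and law: "distr M ((\<Pi>\<^sub>M k\<in>{1..n}. borel) \<Otimes>\<^sub>M (\<Pi>\<^sub>M b\<in>{1..B}. count_space (splits n)))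
        (\<lambda>\<omega>. (eps \<omega>, Nin \<omega>)) = noise_split_law n \<sigma> B"
    and Y: "Y = (\<lambda>\<omega>. responses n p X \<beta> (eps \<omega>))"
    and scr: "\<And>b N. b \<in> {1..B} \<Longrightarrow> N \<in> splits n \<Longrightarrow>
        scr b N \<in> (\<Pi>\<^sub>M k\<in>N. borel) \<rightarrow>\<^sub>M count_space (Pow {1..p})"
    and test: "\<And>b C S N. b \<in> {1..B} \<Longrightarrow> C \<in> \<C> \<Longrightarrow> S \<subseteq> {1..p} \<Longrightarrow> N \<in> splits n \<Longrightarrow>
        test b C S ({1..n} - N) \<in> (\<Pi>\<^sub>M k\<in>{1..n} - N. borel) \<rightarrow>\<^sub>M restrict_space borel {0..1}"
    and Shat: "Shat = (\<lambda>b \<omega>. screened_set (scr b) (Nin \<omega> b) (Y \<omega>))"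
    and pval: "pval = (\<lambda>b C \<omega>. split_pvalue n (test b) C (Shat b \<omega>) (Nin \<omega> b) (Y \<omega>))"
    and m: "\<And>b S C \<R>. b \<in> {1..B} \<Longrightarrow> S \<subseteq> {1..p} \<Longrightarrow> C \<in> \<C> \<Longrightarrow> \<R> \<subseteq> \<C> \<Longrightarrow> 1 \<le> m b S C \<R>"
    and aggr: "aggregation_procedure B aggr"
    and A1: "\<And>b \<omega>. b \<in> {1..B} \<Longrightarrow> \<omega> \<in> space M \<Longrightarrow> real (card (Shat b \<omega>)) < real n / 2"
    and A2: "\<And>b. b \<in> {1..B} \<Longrightarrow>
        measure M {\<omega> \<in> space M. active_set p \<beta> \<subseteq> Shat b \<omega>} \<ge> 1 - \<delta>"
    and A3: "\<And>b C N y a. b \<in> {1..B} \<Longrightarrow> C \<in> \<C> \<Longrightarrow> N \<in> splits n \<Longrightarrow>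
        null_hyp \<beta> (C \<inter> screened_set (scr b) N y) \<Longrightarrow> 0 < a \<Longrightarrow> a < 1 \<Longrightarrow>
        measure M {\<omega> \<in> space M.
          split_pvalue n (test b) C (screened_set (scr b) N y) N (Y \<omega>) \<le> a} \<le> a"
    and A4: "\<And>b \<omega> C \<R> \<S>. b \<in> {1..B} \<Longrightarrow> \<omega> \<in> space M \<Longrightarrow> C \<in> \<C> \<Longrightarrow> \<R> \<subseteq> \<S> \<Longrightarrow> \<S> \<subseteq> \<C> \<Longrightarrow>
        m b (Shat b \<omega>) C \<R> \<ge> m b (Shat b \<omega>) C \<S>"
    and A5: "\<And>b \<omega> \<R>. b \<in> {1..B} \<Longrightarrow> \<omega> \<in> space M \<Longrightarrow> \<R> \<subseteq> \<C> \<Longrightarrow>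
        (\<Sum>C\<in>\<C> - \<R>. of_bool (C \<inter> Shat b \<omega> \<noteq> {}) / m b (Shat b \<omega>) C \<R>) \<le> 1"
    and A6: "aggregation_property B aggr p \<C>"
  shows "measure M {\<omega> \<in> space M.
      rejected B aggr \<alpha> \<C> (\<lambda>b C. pval b C \<omega>) (\<lambda>b. m b (Shat b \<omega>)) i
        \<subseteq> false_nulls p \<beta> \<C>} \<ge> (1 - \<delta>) ^ B - \<alpha>"
proof -
  interpret multisplit M n p B X \<beta> \<sigma> \<C> eps Nin Y scr test m aggr Shat pval
    by (intro multisplit.intro multisplit_axioms.intro)
      (fact prob \<sigma> clusters eps Nin law Y scr test Shat pval m aggr A3)+
  let ?F = "false_nulls p \<beta> \<C>"
  let ?rej = "\<lambda>\<omega>. rejected B aggr \<alpha> \<C> (\<lambda>b C. pval b C \<omega>) (\<lambda>b. m b (Shat b \<omega>)) i"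
  \<comment> \<open>The adjustments are evaluated at the deterministic collection \<open>?F\<close>,
    so no random collection of rejections enters the probability estimate.\<close>
  define bad where "bad = (\<Union>C\<in>\<C> - ?F.
    {\<omega> \<in> space M. aggr (\<lambda>b\<in>{1..B}. adjusted b C ?F \<omega>) \<le> \<alpha>})"
  have F: "?F \<subseteq> \<C>" by (auto simp: false_nulls_def)
  have bad: "bad \<in> events"
    unfolding bad_def using aggregated_sets[OF _ F] finite_clusters by (intro sets.finite_UN) auto
  \<comment> \<open>At \<open>?F\<close> the sum in the single-step property runs over exactly the
    true nulls.\<close>
  have "prob bad \<le> \<alpha>"
    unfolding bad_def using A5[OF _ _ F] by (intro prob_false_rejection_le B \<alpha> F A6)
  have "?rej \<omega> \<subseteq> ?F" if \<omega>: "\<omega> \<in> space M - bad" for \<omega>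
  proof -
    have "rejected_nat B aggr \<alpha> \<C> (\<lambda>b C. pval b C \<omega>) (\<lambda>b. m b (Shat b \<omega>)) k \<subseteq> ?F" for k
    proof (rule rejected_nat_subset[OF aggr _ _ _ F])
      fix b C assume b: "b \<in> {1..B}" and C: "C \<in> \<C>"
      show "0 \<le> pval b C \<omega>"
        using measurable_space[OF pval_measurable(1)[OF b C F]] \<omega> by auto
    next
      fix b C \<R> assume "b \<in> {1..B}" "C \<in> \<C>" "\<R> \<subseteq> \<C>"
      then show "1 \<le> m b (Shat b \<omega>) C \<R>"
        using m[OF _ Shat_subset] \<omega> by auto
    next
      fix b C \<R> \<S> assume "b \<in> {1..B}" "C \<in> \<C>" "\<R> \<subseteq> \<S>" "\<S> \<subseteq> \<C>"
      then show "m b (Shat b \<omega>) C \<S> \<le> m b (Shat b \<omega>) C \<R>"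
        using A4 \<omega> by auto
    next
      fix C assume "C \<in> \<C> - ?F"
      then show "\<alpha> < aggr (\<lambda>b\<in>{1..B}. adj_pvalue (pval b C \<omega>) (m b (Shat b \<omega>) C ?F))"
        using \<omega> by (force simp: bad_def adjusted_def)
    qed
    then show ?thesis by (cases i) (auto simp: rejected_def)
  qed
  then have "prob (space M - bad) \<le> prob {\<omega> \<in> space M. ?rej \<omega> \<subseteq> ?F}"
    by (intro finite_measure_mono rejected_subset_sets) auto
  moreover have "prob (space M - bad) = 1 - prob bad"
    by (rule prob_compl[OF bad])
  \<comment> \<open>The complement of \<open>bad\<close> has probability at least
    \<open>1 - \<alpha>\<close>, which is at least the claimed bound.\<close>
  moreover have "(1 - \<delta>) ^ B \<le> 1"
    using \<delta> by (intro power_le_one) auto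
  ultimately show ?thesis
    using \<open>prob bad \<le> \<alpha>\<close> by linarith
qed

end
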